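(* Let $d\ge 1$ and let $\mathcal{S}\subset\mathbb{R}^d$ be compact. Let $f:\mathcal{S}\to\mathbb{R}$ be a continuous function, possibly non-concave (and, in the PGS case only, assumed non-negative). Assume that $f$ has a global maximum point $\bm{x}^*\in\mathcal{S}$ such that $\sup_{\bm{x}\in\mathcal{S}:\,\|\bm{x}-\bm{x}^*\|\ge\delta} f(\bm{x})<f(\bm{x}^* )$ for every $\delta>0$. Let $\sigma>0$ and, for $N\in\{0,1,2,\dots\}$ and $\bm{\mu}\in\mathbb{R}^d$, define $$F_N(\bm{\mu},\sigma):=(\sqrt{2\pi}\,\sigma)^{-d}\int_{\mathbb{R}^d} f_N(\bm{x})\,e^{-\frac{\|\bm{x}-\bm{\mu}\|^2}{2\sigma^2}}\,d\bm{x},$$ where $f_N$ is the transformed function of either the PGS case or the EPGS case. Then, in each of the two cases, for any $M>0$ and any $\delta>0$ such that $\bar{B}(\bm{x}^*;\delta):=\{\bm{x}\in\mathbb{R}^d:\|\bm{x}-\bm{x}^*\|\le\delta\}\subset\mathcal{S}$, there exists $N_{\delta,\sigma,M}>0$ such that whenever $N>N_{\delta,\sigma,M}$, we have for every $\bm{\mu}\in\mathbb{R}^d$ with $\|\bm{\mu}\|<M$ and every $i\in\{1,\dots,d\}$: $$\frac{\partial F_N(\bm{\mu},\sigma)}{\partial\mu_i}>0\ \text{ if } \mu_i<x_i^*-\delta,\qquad \frac{\partial F_N(\bm{\mu},\sigma)}{\partial\mu_i}<0\ \text{ if } \mu_i>x_i^*+\delta,$$ where $\mu_i$ and $x_i^*$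 denote the $i$-th entries of $\bm{\mu}$ and $\bm{x}^*$.
   Context: $\|\cdot\|$ is the Euclidean norm. The transformed function $f_N:\mathbb{R}^d\to\mathbb{R}$ is defined as follows. PGS (Power Gaussian Smoothing) case: $f_N(\bm{x})=f(\bm{x})^N$ for $\bm{x}\in\mathcal{S}$ and $f_N(\bm{x})=0$ otherwise. EPGS (Exponential Power Gaussian Smoothing) case: $f_N(\bm{x})=e^{Nf(\bm{x})}$ for $\bm{x}\in\mathcal{S}$ and $f_N(\bm{x})=0$ otherwise. *)

theory Defs
  imports "HOL-Analysis.Analysis"
begin

text \<open>A function on \<open>S\<close> is represented by a total function of which only the values on \<open>S\<close> matter.
  The transformed functions extend by zero outside \<open>S\<close>.\<close>

definition pgs :: "(real ^ 'd) set \<Rightarrow> (real ^ 'd \<Rightarrow> real) \<Rightarrow> nat \<Rightarrow> real ^ 'd \<Rightarrow> real" where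
  "pgs S f N x = (if x \<in> S then f x ^ N else 0)"

definition epgs :: "(real ^ 'd) set \<Rightarrow> (real ^ 'd \<Rightarrow> real) \<Rightarrow> nat \<Rightarrow> real ^ 'd \<Rightarrow> real" where
  "epgs S f N x = (if x \<in> S then exp (real N * f x) else 0)"

definition gaussian_smoothing :: "(real ^ 'd \<Rightarrow> real) \<Rightarrow> real ^ 'd \<Rightarrow> real \<Rightarrow> real" where
  "gaussian_smoothing g \<mu> \<sigma> =
     inverse ((sqrt (2 * pi) * \<sigma>) ^ CARD('d)) *
     (LINT x|lborel. g x * exp (- ((norm (x - \<mu>))\<^sup>2 / (2 * \<sigma>\<^sup>2))))"

text \<open>As a relation, so that asserting a partial derivative includes its existence.\<close>

definition has_partial_derivative ::
  "(real ^ 'd \<Rightarrow> real) \<Rightarrow> 'd \<Rightarrow> real \<Rightarrow> real ^ 'd \<Rightarrow> bool" where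
  "has_partial_derivative F i D \<mu> \<longleftrightarrow>
     ((\<lambda>t. F (\<mu> + t *\<^sub>R axis i 1)) has_real_derivative D) (at 0)"

end

theory Submission
  imports Defs
begin

text \<open>
  For the power transform of a non-negative \<open>f\<close>, differentiating the Gaussian kernel under the
  integral gives, up to a positive constant,
  \<open>\<partial>F\<^sub>N/\<partial>\<mu>\<^sub>i = \<integral> (x\<^sub>i - \<mu>\<^sub>i) f\<^sub>N(x) exp (- \<parallel>x - \<mu>\<parallel>\<^sup>2 / (2 \<sigma>\<^sup>2)) dx\<close>
  (\<open>has_partial_derivative_gaussian_smoothing\<close>). If \<open>\<mu>\<^sub>i < x\<^sup>*\<^sub>i - \<delta>\<close>, the integrand is non-negative on
  the ball of radius \<open>\<delta>\<close> about the maximiser, so only the part of \<open>S\<close> outside that ball can make the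
  integral negative. The maximum is strict and \<open>S\<close> is compact, so \<open>f\<close> is there at most some
  \<open>v < f(x\<^sup>*)\<close>, and that part contributes at least \<open>- b v ^ N\<close>. By continuity \<open>f\<close> exceeds some
  \<open>w > v\<close> on a small ball about \<open>x\<^sup>*\<close>; taking the radius of the small ball at most \<open>\<delta>/2\<close> makes
  \<open>x\<^sub>i - \<mu>\<^sub>i \<ge> \<delta>/2\<close> there, so it contributes at least \<open>a w ^ N\<close> with \<open>a > 0\<close>. Neither \<open>a\<close> nor \<open>b\<close>
  depends on \<open>N\<close> or on \<open>\<mu>\<close> as long as \<open>\<parallel>\<mu>\<parallel> < M\<close> (\<open>weighted_moment_lower_bound\<close>), so
  \<open>a w ^ N > b v ^ N\<close> for all large \<open>N\<close>, uniformly in \<open>\<mu>\<close>.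

  The case \<open>\<mu>\<^sub>i > x\<^sup>*\<^sub>i + \<delta>\<close> is the same with all signs reversed, which a factor \<open>s \<in> {1, -1}\<close>
  accounts for. The exponential transform of \<open>f\<close> is the power transform of \<open>exp \<circ> f\<close>, which is
  non-negative and has the same strict maximiser, so only the power transform has to be treated.
\<close>

section \<open>Partial derivatives of a Gaussian smoothing\<close>

text \<open>By the mean value theorem the bound on the derivative dominates the difference quotients, so
  the limit defining the derivative can be exchanged with the integral.\<close>

lemma has_real_derivative_lebesgue_integral:
  fixes \<phi> :: "real \<Rightarrow> 'a \<Rightarrow> real"
  assumes int: "\<And>t. integrable M (\<phi> t)"
    and der: "\<And>t x. x \<in> space M \<Longrightarrow> ((\<lambda>t. \<phi> t x) has_real_derivative \<phi>' t x) (at t)"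
    and bound: "\<And>t x. x \<in> space M \<Longrightarrow> \<bar>\<phi>' t x\<bar> \<le> w x"
    and w: "integrable M w"
  shows "((\<lambda>t. \<integral>x. \<phi> t x \<partial>M) has_real_derivative (\<integral>x. \<phi>' t x \<partial>M)) (at t)"
  unfolding DERIV_def tendsto_at_iff_sequentially
proof (intro allI impI)
  fix X :: "nat \<Rightarrow> real"
  assume nz: "\<forall>n. X n \<in> UNIV - {0}" and X: "X \<longlonglongrightarrow> 0"
  let ?q = "\<lambda>n x. (\<phi> (t + X n) x - \<phi> t x) / X n"
  have qint: "integrable M (?q n)" for n
    using int by auto
  have qlim: "(\<lambda>n. ?q n x) \<longlonglongrightarrow> \<phi>' t x" if "x \<in> space M" for x
    using der[OF that, of t] nz X
    unfolding DERIV_def tendsto_at_iff_sequentially comp_def by blast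
  have qbound: "norm (?q n x) \<le> w x" if "x \<in> space M" for n x
  proof -
    have "norm (\<phi> (t + X n) x - \<phi> t x) \<le> w x * norm (t + X n - t)"
      by (rule field_differentiable_bound[of UNIV "\<lambda>t. \<phi> t x" "\<lambda>t. \<phi>' t x"])
         (use der[OF that] bound[OF that] in auto)
    then show ?thesis
      using nz by (simp add: divide_simps)
  qed
  have "(\<lambda>n. \<integral>x. ?q n x \<partial>M) \<longlonglongrightarrow> (\<integral>x. \<phi>' t x \<partial>M)"
  proof (rule integral_dominated_convergence[where w = w])
    show "?q n \<in> borel_measurable M" for n
      using qint by blast
    then show "\<phi>' t \<in> borel_measurable M"
      using qlim by (rule borel_measurable_LIMSEQ_real[rotated])
  qed (use w qlim qbound in auto)
  moreover have "(\<integral>x. ?q n x \<partial>M) = ((\<integral>x. \<phi> (t + X n) x \<partial>M) - (\<integral>x. \<phi> t x \<partial>M)) / X n" for n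
    using int by simp
  ultimately show "((\<lambda>h. ((\<integral>x. \<phi> (t + h) x \<partial>M) - (\<integral>x. \<phi> t x \<partial>M)) / h) \<circ> X)
      \<longlonglongrightarrow> (\<integral>x. \<phi>' t x \<partial>M)"
    by (simp only: comp_def)
qed

text \<open>What makes the Gaussian kernel Lipschitz in the position of its centre: with it, a multiple of
  \<open>\<bar>g\<bar>\<close> dominates the differentiated integrand, for every integrable \<open>g\<close>.\<close>

lemma abs_mult_exp_neg_square_le:
  fixes y \<sigma> r :: real
  assumes "\<sigma> > 0" "\<bar>y\<bar> \<le> r"
  shows "\<bar>y\<bar> / \<sigma>\<^sup>2 * exp (- (r\<^sup>2 / (2 * \<sigma>\<^sup>2))) \<le> 1 / \<sigma>"
proof -
  let ?u = "r / \<sigma>"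
  have "u \<le> 1 + u\<^sup>2 / 2" for u :: real
    using zero_le_power2[of "u - 1"] by (simp add: power2_diff)
  then have "?u \<le> 1 + ?u\<^sup>2 / 2" .
  also have "\<dots> \<le> exp (?u\<^sup>2 / 2)" by (rule exp_ge_add_one_self)
  finally have "?u / exp (?u\<^sup>2 / 2) \<le> 1"
    by (subst divide_le_eq_1_pos) auto
  then have "?u * exp (- (?u\<^sup>2 / 2)) \<le> 1"
    by (simp only: exp_minus divide_inverse)
  then have "r / \<sigma> * exp (- (r\<^sup>2 / (2 * \<sigma>\<^sup>2))) / \<sigma> \<le> 1 / \<sigma>"
    using assms by (intro divide_right_mono) (auto simp: power_divide mult.commute)
  moreover have "\<bar>y\<bar> / \<sigma>\<^sup>2 * exp (- (r\<^sup>2 / (2 * \<sigma>\<^sup>2))) \<le> r / \<sigma>\<^sup>2 * exp (- (r\<^sup>2 / (2 * \<sigma>\<^sup>2)))"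
    using assms by (intro mult_right_mono divide_right_mono) auto
  ultimately show ?thesis
    by (simp add: power2_eq_square)
qed

lemma integrable_mult_gaussian:
  fixes g :: "real ^ 'd \<Rightarrow> real"
  assumes "integrable lborel g"
  shows "integrable lborel (\<lambda>x. g x * exp (- ((norm (x - \<mu>))\<^sup>2 / (2 * \<sigma>\<^sup>2))))"
proof (rule Bochner_Integration.integrable_bound[OF assms])
  show "AE x in lborel. norm (g x * exp (- ((norm (x - \<mu>))\<^sup>2 / (2 * \<sigma>\<^sup>2)))) \<le> norm (g x)"
    by (auto simp: abs_mult intro!: AE_I2 mult_left_le)
qed (use assms in measurable)

lemma has_real_derivative_gaussian:
  fixes x \<mu> :: "real ^ 'd"
  assumes "\<sigma> \<noteq> 0"
  shows "((\<lambda>t. exp (- ((norm (x - (\<mu> + t *\<^sub>R axis i 1)))\<^sup>2 / (2 * \<sigma>\<^sup>2)))) has_real_derivative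
    (x - (\<mu> + t *\<^sub>R axis i 1)) $ i / \<sigma>\<^sup>2 * exp (- ((norm (x - (\<mu> + t *\<^sub>R axis i 1)))\<^sup>2 / (2 * \<sigma>\<^sup>2))))
    (at t)"
proof -
  let ?y = "x - \<mu>"
  have expand: "(norm (x - (\<mu> + t *\<^sub>R axis i 1)))\<^sup>2 = (norm ?y)\<^sup>2 - 2 * t * ?y $ i + t\<^sup>2" for t
  proof -
    have "x - (\<mu> + t *\<^sub>R axis i 1) = ?y - t *\<^sub>R axis i 1" by simp
    then show ?thesis
      by (simp only: power2_norm_eq_inner)
         (simp add: inner_diff inner_axis inner_axis' inner_commute power2_eq_square algebra_simps)
  qed
  show ?thesis
    unfolding expand using assms
    by (auto intro!: derivative_eq_intros simp: field_simps power2_eq_square)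
qed

lemma has_partial_derivative_gaussian_smoothing:
  fixes g :: "real ^ 'd \<Rightarrow> real"
  assumes g: "integrable lborel g" and \<sigma>: "\<sigma> > 0"
  shows "has_partial_derivative (\<lambda>m. gaussian_smoothing g m \<sigma>) i
    (inverse ((sqrt (2 * pi) * \<sigma>) ^ CARD('d)) / \<sigma>\<^sup>2 *
     (LINT x|lborel. g x * ((x - \<mu>) $ i * exp (- ((norm (x - \<mu>))\<^sup>2 / (2 * \<sigma>\<^sup>2)))))) \<mu>"
proof -
  let ?k = "\<lambda>t x. exp (- ((norm (x - (\<mu> + t *\<^sub>R axis i 1)))\<^sup>2 / (2 * \<sigma>\<^sup>2)))"
  let ?d = "\<lambda>t x. g x * ((x - (\<mu> + t *\<^sub>R axis i 1)) $ i / \<sigma>\<^sup>2 * ?k t x)"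
  have bound: "\<bar>?d t x\<bar> \<le> \<bar>g x\<bar> * (1 / \<sigma>)" for t x
  proof -
    have "\<bar>(x - (\<mu> + t *\<^sub>R axis i 1)) $ i\<bar> / \<sigma>\<^sup>2 * ?k t x \<le> 1 / \<sigma>"
      by (rule abs_mult_exp_neg_square_le[OF \<sigma> component_le_norm_cart])
    then have "\<bar>g x\<bar> * (\<bar>(x - (\<mu> + t *\<^sub>R axis i 1)) $ i\<bar> / \<sigma>\<^sup>2 * ?k t x) \<le> \<bar>g x\<bar> * (1 / \<sigma>)"
      by (rule mult_left_mono) simp
    then show ?thesis
      by (simp add: abs_mult)
  qed
  have "((\<lambda>t. LINT x|lborel. g x * ?k t x) has_real_derivative (LINT x|lborel. ?d 0 x)) (at 0)"
  proof (rule has_real_derivative_lebesgue_integral[where w = "\<lambda>x. \<bar>g x\<bar> * (1 / \<sigma>)"])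
    show "((\<lambda>t. g x * ?k t x) has_real_derivative ?d t x) (at t)" for t x
      using \<sigma> by (intro DERIV_cmult has_real_derivative_gaussian) auto
  qed (use g bound in \<open>auto intro: integrable_mult_gaussian\<close>)
  moreover have "(LINT x|lborel. ?d 0 x) =
      (LINT x|lborel. g x * ((x - \<mu>) $ i * exp (- ((norm (x - \<mu>))\<^sup>2 / (2 * \<sigma>\<^sup>2))))) / \<sigma>\<^sup>2"
    by (subst integral_divide_zero[symmetric]) (simp add: field_simps)
  ultimately show ?thesis
    unfolding has_partial_derivative_def gaussian_smoothing_def
    using DERIV_cmult[of _ _ 0 UNIV "inverse ((sqrt (2 * pi) * \<sigma>) ^ CARD('d))"] by fastforce
qed

section \<open>The sign of the derivative for the power transform\<close>

lemma integrable_pgs: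
  assumes "compact S" "continuous_on S f"
  shows "integrable lborel (pgs S f N)"
proof -
  have "integrable lborel (\<lambda>x. indicator S x *\<^sub>R f x ^ N)"
    using assms by (intro borel_integrable_compact continuous_intros) auto
  moreover have "(\<lambda>x. indicator S x *\<^sub>R f x ^ N) = pgs S f N"
    by (auto simp: pgs_def fun_eq_iff)
  ultimately show ?thesis by simp
qed

text \<open>The factor \<open>s\<close> treats both directions from which \<open>\<mu>\<close> can lie off the slab of half-width
  \<open>\<delta>\<close> about the maximiser. The bound depends on \<open>\<mu>\<close> only through \<open>M\<close>, and on \<open>N\<close> only through the
  two powers.\<close>

lemma weighted_moment_lower_bound:
  fixes S :: "(real ^ 'd) set" and \<mu> c :: "real ^ 'd"
  assumes S: "compact S" and f: "continuous_on S f" and nonneg: "\<And>x. x \<in> S \<Longrightarrow> 0 \<le> f x"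
    and R: "\<And>x. x \<in> S \<Longrightarrow> norm x \<le> R"
    and ball: "cball c \<delta> \<subseteq> S"
    and r: "0 < r" "r \<le> \<delta> / 2"
    and near: "\<And>x. x \<in> cball c r \<Longrightarrow> w \<le> f x" and w: "0 \<le> w"
    and far: "\<And>x. x \<in> S \<Longrightarrow> x \<notin> cball c \<delta> \<Longrightarrow> f x \<le> v" and v: "0 \<le> v"
    and \<sigma>: "0 < \<sigma>" and \<mu>: "norm \<mu> \<le> M"
    and s: "\<bar>s\<bar> = 1" and off: "\<delta> \<le> s * (c - \<mu>) $ i"
  shows "w ^ N * (\<delta> / 2 * exp (- ((R + M)\<^sup>2 / (2 * \<sigma>\<^sup>2))) * measure lborel (cball c r))
      - v ^ N * ((R + M) * measure lborel S)
    \<le> s * (LINT x|lborel. pgs S f N x * ((x - \<mu>) $ i * exp (- ((norm (x - \<mu>))\<^sup>2 / (2 * \<sigma>\<^sup>2)))))"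
proof -
  let ?k = "\<lambda>x. exp (- ((norm (x - \<mu>))\<^sup>2 / (2 * \<sigma>\<^sup>2)))"
  let ?W = "\<lambda>x. pgs S f N x * ((x - \<mu>) $ i * ?k x)"
  let ?a = "w ^ N * (\<delta> / 2 * exp (- ((R + M)\<^sup>2 / (2 * \<sigma>\<^sup>2))))"
  let ?b = "v ^ N * (R + M)"
  let ?L = "\<lambda>x. ?a * indicator (cball c r) x - ?b * indicator S x"
  have c: "c \<in> S" and \<delta>: "0 < \<delta>"
    using ball r by auto
  have small: "cball c r \<subseteq> cball c \<delta>"
    using r by (intro subset_cball) simp
  have RM: "0 \<le> R + M"
    using R[OF c] \<mu> norm_ge_zero[of c] norm_ge_zero[of \<mu>] by linarith
  have b: "0 \<le> ?b"
    using RM v by simp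
  have normxmu: "norm (x - \<mu>) \<le> R + M" if "x \<in> S" for x
    using norm_triangle_ineq4[of x \<mu>] R[OF that] \<mu> by linarith
  have away: "\<delta> - \<rho> \<le> s * (x - \<mu>) $ i" if "x \<in> cball c \<rho>" for x \<rho>
  proof -
    have "\<bar>s * (c - x) $ i\<bar> \<le> norm (c - x)"
      using s component_le_norm_cart[of "c - x" i] by (simp add: abs_mult)
    also have "\<dots> \<le> \<rho>"
      using that by (simp add: dist_norm)
    finally have "s * (c - x) $ i \<le> \<rho>" by linarith
    then show ?thesis
      using off by (simp add: algebra_simps)
  qed
  have lower: "?L x \<le> s * ?W x" for x
  proof -
    consider "x \<in> cball c r" | "x \<in> cball c \<delta>" "x \<notin> cball c r" | "x \<in> S" "x \<notin> cball c \<delta>" | "x \<notin> S"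
      by blast
    then show ?thesis
    proof cases
      case 1
      then have x: "x \<in> S" using ball small by auto
      \<comment> \<open>Half of \<open>\<delta>\<close> is spent on the radius \<open>r\<close>; the other half is left as the margin.\<close>
      have "\<delta> / 2 \<le> s * (x - \<mu>) $ i"
        using away[OF 1] r by linarith
      moreover have "exp (- ((R + M)\<^sup>2 / (2 * \<sigma>\<^sup>2))) \<le> ?k x"
        using power_mono[OF normxmu[OF x], of 2] by (auto intro!: divide_right_mono)
      ultimately have "?a \<le> f x ^ N * (s * (x - \<mu>) $ i * ?k x)"
        using near[OF 1] w \<delta> nonneg[OF x] by (intro mult_mono power_mono) auto
      moreover have "?L x \<le> ?a"
        using b 1 x by simp
      ultimately show ?thesis
        using x by (simp add: pgs_def algebra_simps)
    next
      case 2
      then have x: "x \<in> S" using ball by auto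
      have "0 \<le> f x ^ N * (s * (x - \<mu>) $ i * ?k x)"
        using away[OF 2(1)] nonneg[OF x] by simp
      moreover have "?L x \<le> 0"
        using b 2 by (simp add: indicator_def)
      ultimately show ?thesis
        using x by (simp add: pgs_def algebra_simps)
    next
      case 3
      have "x \<notin> cball c r"
        using 3 small by auto
      then have "?L x = - ?b"
        using 3 by simp
      moreover have "\<bar>s * ?W x\<bar> \<le> ?b"
      proof -
        have "\<bar>s * ?W x\<bar> = f x ^ N * (\<bar>(x - \<mu>) $ i\<bar> * ?k x)"
          using s 3 nonneg by (simp add: pgs_def abs_mult)
        also have "\<dots> \<le> v ^ N * ((R + M) * 1)"
          using component_le_norm_cart[of "x - \<mu>" i] normxmu[OF 3(1)] far[OF 3] nonneg[OF 3(1)] RM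
          by (intro mult_mono power_mono) auto
        finally show ?thesis by simp
      qed
      ultimately show ?thesis by linarith
    next
      case 4
      then have "x \<notin> cball c r"
        using ball small by auto
      then show ?thesis
        using 4 by (simp add: pgs_def)
    qed
  qed
  have fin: "emeasure lborel S < \<infinity>" "emeasure lborel (cball c r) < \<infinity>"
    using S by (simp_all only: emeasure_bounded_finite compact_imp_bounded bounded_cball)
  have meas: "S \<in> sets lborel"
    using S by (simp add: compact_imp_closed)
  have W: "integrable lborel (\<lambda>x. s * ?W x)"
  proof -
    have "integrable lborel (\<lambda>x. indicator S x *\<^sub>R (f x ^ N * ((x - \<mu>) $ i * ?k x)))"
      by (rule borel_integrable_compact[OF S]) (use \<sigma> in \<open>auto intro!: continuous_intros f\<close>)
    moreover have "(\<lambda>x. indicator S x *\<^sub>R (f x ^ N * ((x - \<mu>) $ i * ?k x))) = ?W"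
      by (auto simp: pgs_def fun_eq_iff)
    ultimately show ?thesis by simp
  qed
  have "(LINT x|lborel. ?L x) \<le> (LINT x|lborel. s * ?W x)"
    using fin meas by (intro integral_mono W lower) auto
  moreover have "(LINT x|lborel. ?L x) = ?a * measure lborel (cball c r) - ?b * measure lborel S"
    using fin meas by (subst Bochner_Integration.integral_diff) auto
  ultimately show ?thesis
    by (simp add: mult.assoc)
qed

lemma eventually_power_mult_less:
  fixes v w a b :: real
  assumes "0 \<le> v" "v < w" "0 < a"
  shows "\<exists>N0. \<forall>N>N0. v ^ N * b < w ^ N * a"
proof -
  have w: "0 < w" using assms by simp
  have "(\<lambda>N. (v / w) ^ N * b) \<longlonglongrightarrow> 0 * b"
    using assms w by (intro tendsto_mult LIMSEQ_power_zero tendsto_const) simp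
  then have "\<forall>\<^sub>F N in sequentially. (v / w) ^ N * b < a"
    using assms by (intro order_tendstoD(2)) auto
  then obtain N0 where "\<forall>N>N0. (v / w) ^ N * b < a"
    by (meson eventually_sequentially less_imp_le)
  then have "\<forall>N>N0. v ^ N * b < w ^ N * a"
    using w by (simp add: power_divide field_simps)
  then show ?thesis ..
qed

text \<open>The set of points away from the maximiser may be empty; positivity of the maximum then leaves
  room for \<open>v = 0\<close>.\<close>

lemma strict_maximum_gap:
  fixes f :: "'a::heine_borel \<Rightarrow> real"
  assumes S: "compact S" and f: "continuous_on S f" and nonneg: "\<And>x. x \<in> S \<Longrightarrow> 0 \<le> f x"
    and max: "\<And>x. x \<in> S \<Longrightarrow> x \<noteq> c \<Longrightarrow> f x < f c"
    and pos: "0 < f c" and \<delta>: "0 < \<delta>"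
  shows "\<exists>v. 0 \<le> v \<and> v < f c \<and> (\<forall>x\<in>S. x \<notin> cball c \<delta> \<longrightarrow> f x \<le> v)"
proof (cases "S - ball c \<delta> = {}")
  case True
  then show ?thesis
    using pos ball_subset_cball[of c \<delta>] by blast
next
  case False
  have "compact (S - ball c \<delta>)"
    using S by (simp add: compact_diff)
  then obtain y where y: "y \<in> S - ball c \<delta>" "\<forall>x \<in> S - ball c \<delta>. f x \<le> f y"
    using continuous_attains_sup[of "S - ball c \<delta>" f] False continuous_on_subset[OF f] by blast
  moreover have "y \<noteq> c"
    using y(1) \<delta> by auto
  ultimately have "f y < f c"
    using max by blast
  then show ?thesis
    using y nonneg ball_subset_cball[of c \<delta>] by blast
qed

lemma pgs_smoothing_derivative_sign:
  fixes S :: "(real ^ 'd) set" and c :: "real ^ 'd"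
  assumes S: "compact S" and f: "continuous_on S f" and nonneg: "\<And>x. x \<in> S \<Longrightarrow> 0 \<le> f x"
    and max: "\<And>x. x \<in> S \<Longrightarrow> x \<noteq> c \<Longrightarrow> f x < f c"
    and \<sigma>: "0 < \<sigma>" and \<delta>: "0 < \<delta>" and ball: "cball c \<delta> \<subseteq> S"
  shows "\<exists>N0. \<forall>N>N0. \<forall>\<mu> i s. norm \<mu> \<le> M \<longrightarrow> \<bar>s\<bar> = 1 \<longrightarrow> \<delta> \<le> s * (c - \<mu>) $ i \<longrightarrow>
    (\<exists>D. has_partial_derivative (\<lambda>m. gaussian_smoothing (pgs S f N) m \<sigma>) i D \<mu> \<and> 0 < s * D)"
proof -
  have c: "c \<in> S" using ball \<delta> by auto
  have pos: "0 < f c"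
  proof -
    \<comment> \<open>The ball contains a second point of \<open>S\<close>, whose value is non-negative and below \<open>f c\<close>.\<close>
    obtain e :: "real ^ 'd" where "norm e = \<delta>"
      using vector_choose_size[of \<delta>] \<delta> by auto
    then have "c + e \<in> S" "c + e \<noteq> c"
      using ball \<delta> by (auto simp: subset_iff dist_norm)
    then show ?thesis
      using max nonneg by fastforce
  qed
  obtain v where v: "0 \<le> v" "v < f c" and far: "\<And>x. x \<in> S \<Longrightarrow> x \<notin> cball c \<delta> \<Longrightarrow> f x \<le> v"
    using strict_maximum_gap[OF S f nonneg max pos \<delta>] by blast
  define w where "w = (v + f c) / 2"
  have w: "v < w" "w < f c"
    using v by (auto simp: w_def)
  have "\<exists>\<rho>>0. \<forall>x\<in>S. dist x c < \<rho> \<longrightarrow> dist (f x) (f c) < f c - w"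
    using f c w unfolding continuous_on_iff by auto
  then obtain \<rho> where \<rho>: "0 < \<rho>" "\<And>x. x \<in> S \<Longrightarrow> dist x c < \<rho> \<Longrightarrow> w < f x"
    by (fastforce simp: dist_real_def)
  define r where "r = min (\<rho> / 2) (\<delta> / 2)"
  have r: "0 < r" "r \<le> \<delta> / 2" "r < \<rho>"
    using \<rho> \<delta> by (auto simp: r_def)
  have near: "w \<le> f x" if "x \<in> cball c r" for x
  proof -
    have "x \<in> S" "dist x c < \<rho>"
      using that r \<delta> ball by (auto simp: dist_commute)
    then show ?thesis using \<rho>(2) by fastforce
  qed
  obtain R where R: "\<And>x. x \<in> S \<Longrightarrow> norm x \<le> R"
    using compact_imp_bounded[OF S] by (auto simp: bounded_iff)
  let ?a = "\<delta> / 2 * exp (- ((R + M)\<^sup>2 / (2 * \<sigma>\<^sup>2))) * measure lborel (cball c r)"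
  have "0 < ?a"
    using \<delta> r content_cball_pos[of r c] by simp
  then obtain N0 where N0: "\<And>N. N > N0 \<Longrightarrow> v ^ N * ((R + M) * measure lborel S) < w ^ N * ?a"
    using eventually_power_mult_less[OF v(1) w(1)] by blast
  show ?thesis
  proof (intro exI allI impI conjI)
    fix N \<mu> i and s :: real
    assume "N > N0" and \<mu>: "norm \<mu> \<le> M" and s: "\<bar>s\<bar> = 1" and off: "\<delta> \<le> s * (c - \<mu>) $ i"
    let ?C = "inverse ((sqrt (2 * pi) * \<sigma>) ^ CARD('d)) / \<sigma>\<^sup>2"
    let ?I = "LINT x|lborel. pgs S f N x * ((x - \<mu>) $ i * exp (- ((norm (x - \<mu>))\<^sup>2 / (2 * \<sigma>\<^sup>2))))"
    show "has_partial_derivative (\<lambda>m. gaussian_smoothing (pgs S f N) m \<sigma>) i (?C * ?I) \<mu>"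
      by (rule has_partial_derivative_gaussian_smoothing[OF integrable_pgs[OF S f] \<sigma>])
    have "0 < w ^ N * ?a - v ^ N * ((R + M) * measure lborel S)"
      using N0[OF \<open>N > N0\<close>] by simp
    also have "\<dots> \<le> s * ?I"
      by (rule weighted_moment_lower_bound[OF S f nonneg R ball r(1,2) near _ far v(1) \<sigma> \<mu> s off])
         (use v w in auto)
    finally have "0 < ?C * (s * ?I)"
      using \<sigma> by simp
    then show "0 < s * (?C * ?I)"
      by (simp add: mult.left_commute)
  qed
qed

section \<open>Both transforms\<close>

lemma epgs_eq_pgs_exp: "epgs S f = pgs S (\<lambda>x. exp (f x))"
  by (auto simp: epgs_def pgs_def fun_eq_iff exp_of_nat_mult)

theorem theorem1:
  fixes S :: "(real ^ 'd) set"
    and f :: "real ^ 'd \<Rightarrow> real"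
    and xstar :: "real ^ 'd"
    and \<sigma> :: real
    and fN :: "nat \<Rightarrow> real ^ 'd \<Rightarrow> real"
  assumes "compact S"
    and "continuous_on S f"
    and "xstar \<in> S"
    and "\<forall>x\<in>S. f x \<le> f xstar"
    and "\<forall>\<delta>>0. (SUP x\<in>{x\<in>S. norm (x - xstar) \<ge> \<delta>}. ereal (f x)) < ereal (f xstar)"
    and "\<sigma> > 0"
    and "(fN = pgs S f \<and> (\<forall>x\<in>S. f x \<ge> 0)) \<or> fN = epgs S f"
  shows "\<forall>M>0. \<forall>\<delta>>0. {x. norm (x - xstar) \<le> \<delta>} \<subseteq> S \<longrightarrow>
    (\<exists>N0::real. N0 > 0 \<and> (\<forall>N::nat. real N > N0 \<longrightarrow>
      (\<forall>\<mu>::real ^ 'd. norm \<mu> < M \<longrightarrow> (\<forall>i.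
        (\<mu> $ i < xstar $ i - \<delta> \<longrightarrow>
          (\<exists>D. has_partial_derivative (\<lambda>m. gaussian_smoothing (fN N) m \<sigma>) i D \<mu> \<and> D > 0)) \<and>
        (\<mu> $ i > xstar $ i + \<delta> \<longrightarrow>
          (\<exists>D. has_partial_derivative (\<lambda>m. gaussian_smoothing (fN N) m \<sigma>) i D \<mu> \<and> D < 0))))))"
proof (intro allI impI)
  fix M \<delta> :: real
  assume "0 < M" and \<delta>: "0 < \<delta>" and "{x. norm (x - xstar) \<le> \<delta>} \<subseteq> S"
  then have ball: "cball xstar \<delta> \<subseteq> S"
    by (auto simp: dist_norm norm_minus_commute)
  have max: "f x < f xstar" if "x \<in> S" "x \<noteq> xstar" for x
  proof -
    have "ereal (f x) \<le> (SUP y\<in>{y\<in>S. norm (y - xstar) \<ge> norm (x - xstar)}. ereal (f y))"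
      using that by (intro SUP_upper) simp
    also have "\<dots> < ereal (f xstar)"
      using assms(5) that by simp
    finally show ?thesis by simp
  qed
  obtain h where h: "fN = pgs S h" "continuous_on S h" "\<And>x. x \<in> S \<Longrightarrow> 0 \<le> h x"
    "\<And>x. x \<in> S \<Longrightarrow> x \<noteq> xstar \<Longrightarrow> h x < h xstar"
  proof (cases "fN = epgs S f")
    case True
    show thesis
      by (rule that[of "\<lambda>x. exp (f x)"])
         (use True assms(2) max in \<open>auto simp: epgs_eq_pgs_exp intro: continuous_intros\<close>)
  next
    case False
    then show thesis
      using that[of f] assms(2,7) max by blast
  qed
  obtain N0 where N0: "\<And>N \<mu> i s. N > N0 \<Longrightarrow> norm \<mu> \<le> M \<Longrightarrow> \<bar>s\<bar> = 1 \<Longrightarrow> \<delta> \<le> s * (xstar - \<mu>) $ i \<Longrightarrow>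
      \<exists>D. has_partial_derivative (\<lambda>m. gaussian_smoothing (fN N) m \<sigma>) i D \<mu> \<and> 0 < s * D"
    using pgs_smoothing_derivative_sign[OF assms(1) h(2-4) assms(6) \<delta> ball] unfolding h(1) by metis
  show "\<exists>N0::real. N0 > 0 \<and> (\<forall>N::nat. real N > N0 \<longrightarrow>
      (\<forall>\<mu>::real ^ 'd. norm \<mu> < M \<longrightarrow> (\<forall>i.
        (\<mu> $ i < xstar $ i - \<delta> \<longrightarrow>
          (\<exists>D. has_partial_derivative (\<lambda>m. gaussian_smoothing (fN N) m \<sigma>) i D \<mu> \<and> D > 0)) \<and>
        (\<mu> $ i > xstar $ i + \<delta> \<longrightarrow>
          (\<exists>D. has_partial_derivative (\<lambda>m. gaussian_smoothing (fN N) m \<sigma>) i D \<mu> \<and> D < 0)))))"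
  proof (rule exI[of _ "real (Suc N0)"], intro conjI allI impI)
    fix N :: nat and \<mu> :: "real ^ 'd" and i :: 'd
    assume "real N > real (Suc N0)" and "norm \<mu> < M"
    then have N: "N > N0" and \<mu>: "norm \<mu> \<le> M" by auto
    show "\<exists>D. has_partial_derivative (\<lambda>m. gaussian_smoothing (fN N) m \<sigma>) i D \<mu> \<and> D > 0"
      if "\<mu> $ i < xstar $ i - \<delta>"
      using N0[OF N \<mu>, of 1 i] that by auto
    show "\<exists>D. has_partial_derivative (\<lambda>m. gaussian_smoothing (fN N) m \<sigma>) i D \<mu> \<and> D < 0"
      if "\<mu> $ i > xstar $ i + \<delta>"
      using N0[OF N \<mu>, of "-1" i] that by auto
  qed simp
qed

end
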